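(* Let $\mathcal U$ be a risk frontier with the recursive structure described in the context and suppose $\mathcal I=\{(\mathbb Y_t,\sigma_t)\}_{t\in[T+1]}$ is an information state generator for $\varrho_{\mathcal U}$. Let $\{\varrho_{\bar{\mathcal U},t:T}\}_{t\in[T]}$ be the dynamic risk measure on the information state, with $\varrho_{\bar{\mathcal U},T+1:T}=\bar\Phi_{T+1}$. Then it has a recursive decomposition on the information state: for all $t\in[T]$ and every (Markov) tail payoff stream $X_{t:T}\in\bar{\mathcal L}_{t+1:T+1}$, $$[\varrho_{\bar{\mathcal U},t:T}(X_{t:T})](\sigma_t(h_t))=\min_{z_t,\varphi_t}\{\varphi_t:([X_t\mid s_t],z_t,\varphi_t)\in\bar{\mathcal U}_t(\sigma_t(h_t),\varrho_{\bar{\mathcal U},t+1:T}(X_{t+1:T}))\},\quad\forall h_t\in\mathbb H_t.$$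
   Context: Notation: $[n]=\{0,1,\dots,n\}$, $[n_1,n_2]=\{n_1,\dots,n_2\}$. Fix a horizon $0\le T<\infty$. The data space $\Xi$ and state space $\mathbb S$ are finite, the initial state $s_0\in\mathbb S$ is fixed, and states evolve by $s_{t+1}=f_t(s_t,\xi_t)$ with $f_t:\mathbb S\times\Xi\to\mathbb S$, $t\in[T-1]$. $\Omega$ is the finite set of trajectories $\omega=(s_0,\xi_0,\dots,\xi_T)$; $\{\xi_t\}_{t\in[T]}$ are independent, $\xi_t\sim P_t\in\mathcal P(\Xi)$, with $\mathbb P=P_0\times\cdots\times P_T$. For $t\in[T+1]$, $h_t=(s_0,\xi_0,\dots,\xi_{t-1})$ is the history up to the beginning of period $t$, $\mathbb H_t$ is the set of such histories, $\mathscr F_t=\sigma(h_t)$, and $\mathcal L_t=\mathcal L^\infty(\Omega,\mathscr F_t,\mathbb P)$. $\mathcal L_{t+1:T+1}=\prod_{k=t+1}^{T+1}\mathcal L_k$, $\mathcal L_{t:T}=\prod_{k=t}^{T}\mathcal L_k$. A payoff stream is $X_{t:T}\in\mathcal L_{t+1:T+1}$ with $X_k\in\mathcal L_{k+1}$; disbursements $Z_{t:T}\in\mathcal L_{t:T}$ and premiums $\Phi_{t:T}\in\mathcal L_{t:T}$ have $Z_k,\Phi_k\in\mathcal L_k$. $\Phi_0$ is a constant, denoted $\varphi_0$. Inequalities hold componentwise and almost surely. $[X\mid h_t]$ denotes the conditional random variable $X$ given $h_t$ (similarly $[X\mid y_t]$, $[X\mid s_t]$); for a quantity determined by the conditioning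 it is a number. A payoff stream is Markov if $X_t$ depends on the history $h_t$ only through $s_t$, so the period-$t$ conditional payoff is $[X_t\mid h_t]=[X_t\mid s_t]$. The decision maker has perfect recall: $h_t$ determines the past values $(X_{0:t-1},Z_{0:t-1},\Phi_{0:t-1})$. Risk frontier: a set $\mathcal U\subset\mathcal L_{1:T+1}\times\mathcal L_{0:T}\times\mathcal L_{0:T}$ is a risk frontier if: (i) $(X_{0:T},Z_{0:T},\Phi_{0:T})\in\mathcal U$ implies $(X'_{0:T},Z_{0:T},\Phi_{0:T})\in\mathcal U$ for all $X'_{0:T}\ge X_{0:T}$; (ii) $(X_{0:T},Z_{0:T},\Phi_{0:T})\in\mathcal U$ implies $(X_{0:T},Z_{0:T},\Phi_{0:T}+\Phi'_{0:T})\in\mathcal U$ for all non-increasing processes $\Phi'_{0:T}\ge 0$, i.e. $\Phi'_t(h_t)\ge\mathbb E[\Phi'_{t+1}\mid h_t]$ for all $h_t$ and $t\in[T-1]$; (iii) $(X_{0:T},Z_{0:T},\Phi_{0:T})\in\mathcal U$ and $Z'_{0:T}\ge Z_{0:T}$ imply $(X_{0:T},Z'_{0:T},\Phi'_{0:T})\in\mathcal U$ for some $\Phi'_{0:T}\ge\Phi_{0:T}$; (iv) $\mathcal U$ is closed. Its GCR is $\varrho_{\mathcal U}(X_{0:T})=\min_{Z_{0:T},\Phi_{0:T}}\{\varphi_0:(X_{0:T},Z_{0:T},\Phi_{0:T})\in\mathcal U\}$. Recursive structure: a terminal input $\Phi_{T+1}\in\mathcal L_{T+1}$ is fixed and there exist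 correspondences $\mathcal U_t:\mathbb H_t\times\mathcal L_{t+1}\rightrightarrows\mathcal L_{t+1}\times\mathbb R\times\mathbb R$, $t\in[T]$, such that (a) $\mathcal U=\{(X_{0:T},Z_{0:T},\Phi_{0:T}):[(X_t,Z_t,\Phi_t)\mid h_t]\in\mathcal U_t(h_t,\Phi_{t+1}),\ \forall h_t\in\mathbb H_t,\ \forall t\in[T]\}$; (b) if $(X_t,z_t,\varphi_t)\in\mathcal U_t(h_t,\Phi_{t+1})$ and $X_t\le X'_t$ then $(X'_t,z_t,\varphi_t)\in\mathcal U_t(h_t,\Phi_{t+1})$; (c) $\Phi_{t+1}\le\Phi'_{t+1}$ implies $\mathcal U_t(h_t,\Phi'_{t+1})\subset\mathcal U_t(h_t,\Phi_{t+1})$ for all $h_t$. Information state: $\{\mathbb Y_t\}_{t\in[T+1]}$ are Banach spaces and $\sigma_t:\mathbb H_t\to\mathbb Y_t$ are history compression functions; $\mathbb S$ is absorbed into $\mathbb Y_t$, i.e. $s_t$ is a component of $y_t=\sigma_t(h_t)$. $Y_t=\sigma_t(h_t)$ is the information state, $\mathcal G_t$ is the corresponding $\sigma$-field, and $\bar{\mathcal L}_t\subset\mathcal L_t$ is the set of random variables that are functions of the information state, i.e. $X(h_t)=X(\sigma_t(h_t))$. $\bar{\mathcal L}_{t+1:T+1}$, $\bar{\mathcal L}_{t:T}$ are the corresponding products. $\mathcal I$ is an information state generator for $\varrho_{\mathcal U}$ if: (1) $\Pr(Y_{t+1}\in B\mid h_t,z_t)=\Pr(Y_{t+1}\in B\mid\sigma_t(h_t),z_t)$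 for all $t\in[T-1]$, $B\in\mathcal G_{t+1}$, $h_t\in\mathbb H_t$, $z_t\in\mathbb R$ (the period-$t$ disbursement); (2) the terminal input satisfies $\bar\Phi_{T+1}=\Phi_{T+1}\in\bar{\mathcal L}_{T+1}$; (3) for all $t\in[T]$, $\mathcal U_t(h_t,\bar\Phi_{t+1})=\mathcal U_t(h'_t,\bar\Phi_{t+1})$ for all $\bar\Phi_{t+1}\in\bar{\mathcal L}_{t+1}$ and all $h_t,h'_t\in\mathbb H_t$ with $\sigma_t(h_t)=\sigma_t(h'_t)$. Compressed risk frontiers: $\bar{\mathcal U}_t(y_t,\bar\Phi_{t+1})=\mathcal U_t(h_t,\bar\Phi_{t+1})$ for any $h_t$ with $\sigma_t(h_t)=y_t$, $\bar\Phi_{t+1}\in\bar{\mathcal L}_{t+1}$ (here and below $y_t$ ranges over values attained by $\sigma_t$). For $t\in[T]$, $$\bar{\mathcal U}_{t:T}(y_t)=\{(X_{t:T},\bar Z_{t:T},\bar\Phi_{t:T}):[(X_k,\bar Z_k,\bar\Phi_k)\mid y_k]\in\bar{\mathcal U}_k(y_k,\bar\Phi_{k+1}),\ \forall y_k\in\mathbb Y_k,\ \forall k\in[t,T]\},$$ with $\bar Z_{t:T},\bar\Phi_{t:T}\in\bar{\mathcal L}_{t:T}$, and $\varrho_{\bar{\mathcal U},t:T}:\bar{\mathcal L}_{t+1:T+1}\to\bar{\mathcal L}_t$ is $$[\varrho_{\bar{\mathcal U},t:T}(X_{t:T})](y_t)=\min_{\bar Z_{t:T},\bar\Phi_{t:T}}\{\bar\Phi_t(y_t):[(X_{t:T},\bar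 Z_{t:T},\bar\Phi_{t:T})\mid y_t]\in\bar{\mathcal U}_{t:T}(y_t)\},$$ where the minima are understood to exist. *)

theory Defs
  imports "HOL-Probability.Probability"
begin

section \<open>Trajectories, histories and random variables\<close>

text \<open>
  The data space is a type \<open>'x\<close> and the state space a type \<open>'s\<close>, both of class \<open>finite\<close>.  As the
  initial state is fixed, a history $h_t = (s_0,\xi_0,\dots,\xi_{t-1})$ is encoded by the list of
  its \<open>t\<close> data points.
\<close>

definition hists :: "nat \<Rightarrow> 'x list set" where
  "hists t = {h. length h = t}"

fun state :: "(nat \<Rightarrow> 's \<Rightarrow> 'x \<Rightarrow> 's) \<Rightarrow> 's \<Rightarrow> nat \<Rightarrow> 'x list \<Rightarrow> 's" where
  "state f s0 0 h = s0"
| "state f s0 (Suc t) h = f t (state f s0 t h) (h ! t)"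

definition trajectory_law :: "nat \<Rightarrow> (nat \<Rightarrow> 'x pmf) \<Rightarrow> (nat \<Rightarrow> 'x) pmf" where
  "trajectory_law T P = Pi_pmf {..T} undefined P"

definition history :: "nat \<Rightarrow> (nat \<Rightarrow> 'x) \<Rightarrow> 'x list" where
  "history t \<omega> = map \<omega> [0..<t]"

text \<open>
  $\mathcal L_t$: random variables measurable with respect to $h_t$ are identified with the
  functions of $h_t$.  There are finitely many histories, so boundedness is automatic.
\<close>

definition rv :: "nat \<Rightarrow> ('x list \<Rightarrow> real) set" where
  "rv t = extensional (hists t)"

text \<open>
  Inequalities between random variables are almost sure inequalities, but $\mathcal U_t(h_t,\cdot)$
  and the minima below are also evaluated at histories of probability zero, if there are any.
  Wherever an inequality occurs as a premise of one of the axioms below it is therefore required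
  at every history; this makes the axiom weaker than its almost sure version.  (Almost sure
  premises would let the premiums in (ii) decrease without bound at histories of probability zero,
  so that the minima could not exist there.)  If every $P_t$ has full support, \<open>le_rv\<close> and \<open>le_as\<close>
  agree.
\<close>

definition le_rv :: "nat \<Rightarrow> ('x list \<Rightarrow> real) \<Rightarrow> ('x list \<Rightarrow> real) \<Rightarrow> bool" where
  "le_rv t X X' \<longleftrightarrow> (\<forall>h\<in>hists t. X h \<le> X' h)"

definition le_as ::
  "nat \<Rightarrow> (nat \<Rightarrow> 'x pmf) \<Rightarrow> nat \<Rightarrow> ('x list \<Rightarrow> real) \<Rightarrow> ('x list \<Rightarrow> real) \<Rightarrow> bool" where
  "le_as T P t X X' \<longleftrightarrow>
     (AE \<omega> in measure_pmf (trajectory_law T P). X (history t \<omega>) \<le> X' (history t \<omega>))"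

text \<open>
  $\mathcal L_{t+1:T+1}$ (payoff streams: the period-\<open>k\<close> payoff is a function of $h_{k+1}$) and
  $\mathcal L_{t:T}$ (disbursements and premiums).
\<close>

definition payoffs :: "nat \<Rightarrow> nat \<Rightarrow> (nat \<Rightarrow> 'x list \<Rightarrow> real) set" where
  "payoffs t T = (\<Pi>\<^sub>E k\<in>{t..T}. rv (Suc k))"

definition adapted :: "nat \<Rightarrow> nat \<Rightarrow> (nat \<Rightarrow> 'x list \<Rightarrow> real) set" where
  "adapted t T = (\<Pi>\<^sub>E k\<in>{t..T}. rv k)"

text \<open>
  The conditional random variable $[X \mid h_t]$ for $X \in \mathcal L_k$, again as an element of
  $\mathcal L_k$: the past is replaced by $h_t$, the data from period \<open>t\<close> on stay random.  By
  independence the data from period \<open>t\<close> on keep their law under conditioning on $h_t$.  For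
  $X \in \mathcal L_t$ this is the constant \<open>X h\<close>, for which \<open>X h\<close> itself is written below.
\<close>

definition given_hist :: "nat \<Rightarrow> 'x list \<Rightarrow> ('x list \<Rightarrow> real) \<Rightarrow> 'x list \<Rightarrow> real" where
  "given_hist k h X = (\<lambda>h'\<in>hists k. X (h @ drop (length h) h'))"

text \<open>
  Quantities which depend on $h_t$ only through a statistic \<open>g\<close> of $h_t$ (the state $s_t$ or the
  information state $y_t$) are evaluated at any history on which \<open>g\<close> takes the prescribed value.
\<close>

definition some_hist :: "nat \<Rightarrow> ('x list \<Rightarrow> 'v) \<Rightarrow> 'v \<Rightarrow> 'x list" where
  "some_hist t g v = inv_into (hists t) g v"

definition markov ::
  "(nat \<Rightarrow> 's \<Rightarrow> 'x \<Rightarrow> 's) \<Rightarrow> 's \<Rightarrow> nat \<Rightarrow> nat \<Rightarrow> (nat \<Rightarrow> 'x list \<Rightarrow> real) \<Rightarrow> bool" where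
  "markov f s0 t T X \<longleftrightarrow>
     (\<forall>k\<in>{t..T}. \<forall>h\<in>hists k.
        given_hist (Suc k) h (X k) =
        given_hist (Suc k) (some_hist k (state f s0 k) (state f s0 k h)) (X k))"


section \<open>Risk frontiers\<close>

text \<open>
  In (ii) the conditional expectation given $h_t$ is the expectation over $\xi_t$, which is
  independent of $h_t$.  In (iv) \<open>closed\<close> refers to pointwise convergence, which on these
  finite-dimensional spaces is the norm topology.
\<close>

definition risk_frontier ::
  "nat \<Rightarrow> (nat \<Rightarrow> 'x::finite pmf) \<Rightarrow>
   ((nat \<Rightarrow> 'x list \<Rightarrow> real) \<times> (nat \<Rightarrow> 'x list \<Rightarrow> real) \<times> (nat \<Rightarrow> 'x list \<Rightarrow> real)) set \<Rightarrow> bool" where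
  "risk_frontier T P \<U> \<longleftrightarrow>
     \<U> \<subseteq> payoffs 0 T \<times> adapted 0 T \<times> adapted 0 T \<and>
     \<comment> \<open>(i)\<close>
     (\<forall>X Z \<Phi>. \<forall>X'\<in>payoffs 0 T.
        (X, Z, \<Phi>) \<in> \<U> \<and> (\<forall>k\<le>T. le_rv (Suc k) (X k) (X' k)) \<longrightarrow> (X', Z, \<Phi>) \<in> \<U>) \<and>
     \<comment> \<open>(ii)\<close>
     (\<forall>X Z \<Phi>. \<forall>\<Phi>'\<in>adapted 0 T.
        (X, Z, \<Phi>) \<in> \<U> \<and> (\<forall>k\<le>T. le_rv k (\<lambda>_. 0) (\<Phi>' k)) \<and>
        (\<forall>t<T. \<forall>h\<in>hists t. \<Phi>' t h \<ge> measure_pmf.expectation (P t) (\<lambda>\<xi>. \<Phi>' (Suc t) (h @ [\<xi>])))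
        \<longrightarrow> (X, Z, \<lambda>k\<in>{0..T}. \<lambda>h\<in>hists k. \<Phi> k h + \<Phi>' k h) \<in> \<U>) \<and>
     \<comment> \<open>(iii)\<close>
     (\<forall>X Z \<Phi>. \<forall>Z'\<in>adapted 0 T.
        (X, Z, \<Phi>) \<in> \<U> \<and> (\<forall>k\<le>T. le_rv k (Z k) (Z' k)) \<longrightarrow>
        (\<exists>\<Phi>'\<in>adapted 0 T. (\<forall>k\<le>T. le_as T P k (\<Phi> k) (\<Phi>' k)) \<and> (X, Z', \<Phi>') \<in> \<U>)) \<and>
     \<comment> \<open>(iv)\<close>
     closed \<U>"

text \<open>
  \<open>U t h \<Phi>\<close> is $\mathcal U_t(h_t,\Phi_{t+1})$ and \<open>\<Phi>T\<close> is the terminal input $\Phi_{T+1}$.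
\<close>

type_synonym 'x frontiers =
  "nat \<Rightarrow> 'x list \<Rightarrow> ('x list \<Rightarrow> real) \<Rightarrow> (('x list \<Rightarrow> real) \<times> real \<times> real) set"

definition recursive_structure ::
  "nat \<Rightarrow>
   ((nat \<Rightarrow> 'x list \<Rightarrow> real) \<times> (nat \<Rightarrow> 'x list \<Rightarrow> real) \<times> (nat \<Rightarrow> 'x list \<Rightarrow> real)) set \<Rightarrow>
   'x frontiers \<Rightarrow> ('x list \<Rightarrow> real) \<Rightarrow> bool" where
  "recursive_structure T \<U> U \<Phi>T \<longleftrightarrow>
     \<Phi>T \<in> rv (Suc T) \<and>
     (\<forall>t\<le>T. \<forall>h\<in>hists t. \<forall>\<Phi>\<in>rv (Suc t). U t h \<Phi> \<subseteq> rv (Suc t) \<times> UNIV \<times> UNIV) \<and>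
     \<comment> \<open>(a)\<close>
     \<U> = {(X, Z, \<Phi>). X \<in> payoffs 0 T \<and> Z \<in> adapted 0 T \<and> \<Phi> \<in> adapted 0 T \<and>
            (\<forall>t\<le>T. \<forall>h\<in>hists t.
               (given_hist (Suc t) h (X t), Z t h, \<Phi> t h) \<in> U t h ((\<Phi>(Suc T := \<Phi>T)) (Suc t)))} \<and>
     \<comment> \<open>(b)\<close>
     (\<forall>t\<le>T. \<forall>h\<in>hists t. \<forall>\<Phi>\<in>rv (Suc t). \<forall>X. \<forall>X'\<in>rv (Suc t). \<forall>z \<phi>.
        (X, z, \<phi>) \<in> U t h \<Phi> \<and> le_rv (Suc t) X X' \<longrightarrow> (X', z, \<phi>) \<in> U t h \<Phi>) \<and>
     \<comment> \<open>(c)\<close>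
     (\<forall>t\<le>T. \<forall>\<Phi>\<in>rv (Suc t). \<forall>\<Phi>'\<in>rv (Suc t).
        le_rv (Suc t) \<Phi> \<Phi>' \<longrightarrow> (\<forall>h\<in>hists t. U t h \<Phi>' \<subseteq> U t h \<Phi>))"


section \<open>Information states\<close>

text \<open>
  The Banach spaces $\mathbb Y_t$ are given as closed linear subspaces \<open>Y t\<close> of one ambient Banach
  space; every finite family of Banach spaces arises in this way inside its direct sum.  The
  state $s_t$ exists for $t \le T$ only.
\<close>

definition information_state ::
  "nat \<Rightarrow> (nat \<Rightarrow> 's \<Rightarrow> 'x \<Rightarrow> 's) \<Rightarrow> 's \<Rightarrow> (nat \<Rightarrow> 'y::banach set) \<Rightarrow> (nat \<Rightarrow> 'x list \<Rightarrow> 'y) \<Rightarrow> bool" where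
  "information_state T f s0 Y \<sigma> \<longleftrightarrow>
     (\<forall>t\<le>Suc T. subspace (Y t) \<and> closed (Y t) \<and> \<sigma> t \<in> hists t \<rightarrow> Y t) \<and>
     (\<forall>t\<le>T. \<exists>\<pi>. \<forall>h\<in>hists t. state f s0 t h = \<pi> (\<sigma> t h))"

definition rv_info :: "(nat \<Rightarrow> 'x list \<Rightarrow> 'y) \<Rightarrow> nat \<Rightarrow> ('x list \<Rightarrow> real) set" where
  "rv_info \<sigma> t = {X \<in> rv t. \<exists>g. \<forall>h\<in>hists t. X h = g (\<sigma> t h)}"

definition payoffs_info ::
  "(nat \<Rightarrow> 'x list \<Rightarrow> 'y) \<Rightarrow> nat \<Rightarrow> nat \<Rightarrow> (nat \<Rightarrow> 'x list \<Rightarrow> real) set" where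
  "payoffs_info \<sigma> t T = (\<Pi>\<^sub>E k\<in>{t..T}. rv_info \<sigma> (Suc k))"

definition adapted_info ::
  "(nat \<Rightarrow> 'x list \<Rightarrow> 'y) \<Rightarrow> nat \<Rightarrow> nat \<Rightarrow> (nat \<Rightarrow> 'x list \<Rightarrow> real) set" where
  "adapted_info \<sigma> t T = (\<Pi>\<^sub>E k\<in>{t..T}. rv_info \<sigma> k)"

text \<open>
  In (1), $z_t$ is a value of a period-\<open>t\<close> disbursement $Z_t \in \mathcal L_t$, and the conditioning
  event is required to have positive probability.  The information state takes finitely many
  values, so the events of its $\sigma$-field are those of the form $Y_{t+1} \in B$, for any set \<open>B\<close>.
\<close>

definition information_state_generator ::
  "nat \<Rightarrow> (nat \<Rightarrow> 's \<Rightarrow> 'x \<Rightarrow> 's) \<Rightarrow> 's \<Rightarrow> (nat \<Rightarrow> 'x::finite pmf) \<Rightarrow> 'x frontiers \<Rightarrow> ('x list \<Rightarrow> real) \<Rightarrow>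
   (nat \<Rightarrow> 'y::banach set) \<Rightarrow> (nat \<Rightarrow> 'x list \<Rightarrow> 'y) \<Rightarrow> bool" where
  "information_state_generator T f s0 P U \<Phi>T Y \<sigma> \<longleftrightarrow>
     information_state T f s0 Y \<sigma> \<and>
     \<comment> \<open>(1)\<close>
     (\<forall>t<T. \<forall>B. \<forall>h\<in>hists t. \<forall>Z\<in>rv t. \<forall>z.
        \<P>(\<omega> in trajectory_law T P. history t \<omega> = h \<and> Z (history t \<omega>) = z) > 0 \<longrightarrow>
        \<P>(\<omega> in trajectory_law T P. \<sigma> (Suc t) (history (Suc t) \<omega>) \<in> B
            \<bar> history t \<omega> = h \<and> Z (history t \<omega>) = z) =
        \<P>(\<omega> in trajectory_law T P. \<sigma> (Suc t) (history (Suc t) \<omega>) \<in> B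
            \<bar> \<sigma> t (history t \<omega>) = \<sigma> t h \<and> Z (history t \<omega>) = z)) \<and>
     \<comment> \<open>(2)\<close>
     \<Phi>T \<in> rv_info \<sigma> (Suc T) \<and>
     \<comment> \<open>(3)\<close>
     (\<forall>t\<le>T. \<forall>\<Phi>\<in>rv_info \<sigma> (Suc t). \<forall>h\<in>hists t. \<forall>h'\<in>hists t.
        \<sigma> t h = \<sigma> t h' \<longrightarrow> U t h \<Phi> = U t h' \<Phi>)"


section \<open>The dynamic risk measure on the information state\<close>

definition compressed_frontier ::
  "(nat \<Rightarrow> 'x list \<Rightarrow> 'y) \<Rightarrow> 'x frontiers \<Rightarrow> nat \<Rightarrow> 'y \<Rightarrow> ('x list \<Rightarrow> real) \<Rightarrow>
   (('x list \<Rightarrow> real) \<times> real \<times> real) set" where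
  "compressed_frontier \<sigma> U t y \<Phi> = U t (some_hist t (\<sigma> t) y) \<Phi>"

text \<open>
  $\bar{\mathcal U}_{t:T}(y_t)$.  The constraints are imposed at all attained information states of
  the periods \<open>t, \<dots>, T\<close>, not only at those which can follow $y_t$, so the set does not vary with
  $y_t$; the current information state enters the risk measure as the point where the premium is
  evaluated.
\<close>

definition compressed_tail_frontier ::
  "nat \<Rightarrow> 'x frontiers \<Rightarrow> ('x list \<Rightarrow> real) \<Rightarrow> (nat \<Rightarrow> 'x list \<Rightarrow> 'y) \<Rightarrow> nat \<Rightarrow> 'y \<Rightarrow>
   ((nat \<Rightarrow> 'x list \<Rightarrow> real) \<times> (nat \<Rightarrow> 'x list \<Rightarrow> real) \<times> (nat \<Rightarrow> 'x list \<Rightarrow> real)) set" where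
  "compressed_tail_frontier T U \<Phi>T \<sigma> t y =
     {(X, Z, \<Phi>). X \<in> payoffs t T \<and> Z \<in> adapted_info \<sigma> t T \<and> \<Phi> \<in> adapted_info \<sigma> t T \<and>
        (\<forall>k\<in>{t..T}. \<forall>y'\<in>\<sigma> k ` hists k.
           (given_hist (Suc k) (some_hist k (\<sigma> k) y') (X k),
            Z k (some_hist k (\<sigma> k) y'), \<Phi> k (some_hist k (\<sigma> k) y'))
           \<in> compressed_frontier \<sigma> U k y' ((\<Phi>(Suc T := \<Phi>T)) (Suc k)))}"

definition info_premiums ::
  "nat \<Rightarrow> 'x frontiers \<Rightarrow> ('x list \<Rightarrow> real) \<Rightarrow> (nat \<Rightarrow> 'x list \<Rightarrow> 'y) \<Rightarrow> nat \<Rightarrow>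
   (nat \<Rightarrow> 'x list \<Rightarrow> real) \<Rightarrow> 'y \<Rightarrow> real set" where
  "info_premiums T U \<Phi>T \<sigma> t X y =
     {\<Phi> t (some_hist t (\<sigma> t) y) |Z \<Phi>. (X, Z, \<Phi>) \<in> compressed_tail_frontier T U \<Phi>T \<sigma> t y}"

definition is_minimum :: "real set \<Rightarrow> real \<Rightarrow> bool" where
  "is_minimum A m \<longleftrightarrow> m \<in> A \<and> (\<forall>a\<in>A. m \<le> a)"

text \<open>
  $[\varrho_{\bar{\mathcal U},t:T}(X_{t:T})](y_t)$, with
  $\varrho_{\bar{\mathcal U},T+1:T} = \bar\Phi_{T+1}$.
\<close>

definition info_risk ::
  "nat \<Rightarrow> 'x frontiers \<Rightarrow> ('x list \<Rightarrow> real) \<Rightarrow> (nat \<Rightarrow> 'x list \<Rightarrow> 'y) \<Rightarrow> nat \<Rightarrow>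
   (nat \<Rightarrow> 'x list \<Rightarrow> real) \<Rightarrow> 'y \<Rightarrow> real" where
  "info_risk T U \<Phi>T \<sigma> t X y =
     (if t \<le> T then LEAST \<phi>. \<phi> \<in> info_premiums T U \<Phi>T \<sigma> t X y
      else \<Phi>T (some_hist (Suc T) (\<sigma> (Suc T)) y))"

text \<open>The same quantity as an element of $\bar{\mathcal L}_t$.\<close>

definition info_risk_rv ::
  "nat \<Rightarrow> 'x frontiers \<Rightarrow> ('x list \<Rightarrow> real) \<Rightarrow> (nat \<Rightarrow> 'x list \<Rightarrow> 'y) \<Rightarrow> nat \<Rightarrow>
   (nat \<Rightarrow> 'x list \<Rightarrow> real) \<Rightarrow> 'x list \<Rightarrow> real" where
  "info_risk_rv T U \<Phi>T \<sigma> t X = (\<lambda>h\<in>hists t. info_risk T U \<Phi>T \<sigma> t X (\<sigma> t h))"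

text \<open>The minima which define the dynamic risk measure exist.\<close>

definition info_risk_well_defined ::
  "nat \<Rightarrow> (nat \<Rightarrow> 's \<Rightarrow> 'x \<Rightarrow> 's) \<Rightarrow> 's \<Rightarrow> 'x frontiers \<Rightarrow> ('x list \<Rightarrow> real) \<Rightarrow> (nat \<Rightarrow> 'x list \<Rightarrow> 'y) \<Rightarrow> bool" where
  "info_risk_well_defined T f s0 U \<Phi>T \<sigma> \<longleftrightarrow>
     (\<forall>t\<le>T. \<forall>X\<in>payoffs_info \<sigma> t T. markov f s0 t T X \<longrightarrow>
        (\<forall>y\<in>\<sigma> t ` hists t. \<exists>m. is_minimum (info_premiums T U \<Phi>T \<sigma> t X y) m))"

end

theory Submission
  imports Defs
begin

text \<open>
  The premium process made of the minimal premiums \<open>\<rho>\<^sub>k\<close> of all tail problems is feasible for the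
  tail problem of every period \<open>t\<close>: a minimizer of the period-\<open>k\<close> problem at \<open>y\<close> has a
  continuation that is feasible for period \<open>k + 1\<close>, hence dominates \<open>\<rho>\<^sub>k\<^sub>+\<^sub>1\<close> at every
  information state, and by the monotonicity (c) it may be replaced by \<open>\<rho>\<^sub>k\<^sub>+\<^sub>1\<close>.  So the minimal
  premium at \<open>y\<close> is feasible in the one-step problem.  Conversely, a one-step feasible premium at
  \<open>y\<close>, completed by the minimal premiums everywhere else, is feasible for the tail problem, so it
  is not below the minimum.
\<close>

section \<open>Representatives of statistics and restriction to later tails\<close>

lemma some_hist:
  assumes "h \<in> hists t"
  shows "some_hist t g (g h) \<in> hists t" "g (some_hist t g (g h)) = g h"
  using assms by (auto simp: some_hist_def inv_into_into f_inv_into_f)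

lemma frontier_antimono:
  assumes "recursive_structure T \<U> U \<Phi>T" "t \<le> T" "h \<in> hists t"
    and "\<Phi> \<in> rv (Suc t)" "\<Phi>' \<in> rv (Suc t)" "le_rv (Suc t) \<Phi> \<Phi>'"
  shows "U t h \<Phi>' \<subseteq> U t h \<Phi>"
proof -
  have "\<forall>t\<le>T. \<forall>\<Phi>\<in>rv (Suc t). \<forall>\<Phi>'\<in>rv (Suc t).
      le_rv (Suc t) \<Phi> \<Phi>' \<longrightarrow> (\<forall>h\<in>hists t. U t h \<Phi>' \<subseteq> U t h \<Phi>)"
    using assms(1) unfolding recursive_structure_def by (elim conjE)
  with assms(2-) show ?thesis by blast
qed

lemma rv_info_some_hist:
  assumes "X \<in> rv_info \<sigma> t" "h \<in> hists t"
  shows "X (some_hist t (\<sigma> t) (\<sigma> t h)) = X h"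
  using assms some_hist[OF assms(2), of "\<sigma> t"] by (auto simp: rv_info_def)

lemma rv_info_restrict: "(\<lambda>h\<in>hists t. g (\<sigma> t h)) \<in> rv_info \<sigma> t"
  by (auto simp: rv_info_def rv_def)

lemma restrict_payoffs_info:
  assumes "X \<in> payoffs_info \<sigma> t T" "t \<le> k"
  shows "restrict X {k..T} \<in> payoffs_info \<sigma> k T"
  using assms by (auto simp: payoffs_info_def)

lemma restrict_adapted_info:
  assumes "X \<in> adapted_info \<sigma> t T" "t \<le> k"
  shows "restrict X {k..T} \<in> adapted_info \<sigma> k T"
  using assms by (auto simp: adapted_info_def)

lemma restrict_payoffs:
  assumes "X \<in> payoffs t T" "t \<le> k"
  shows "restrict X {k..T} \<in> payoffs k T"
  using assms by (auto simp: payoffs_def)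

lemma payoffs_info_imp_payoffs: "X \<in> payoffs_info \<sigma> t T \<Longrightarrow> X \<in> payoffs t T"
  by (auto simp: payoffs_info_def payoffs_def rv_info_def PiE_iff)

lemma restrict_markov:
  assumes "markov f s0 t T X" "t \<le> k"
  shows "markov f s0 k T (restrict X {k..T})"
  using assms by (auto simp: markov_def)

text \<open>The constraints bind period by period and at all attained information states, so
  dropping the periods before \<open>k\<close> keeps the remaining ones. As the set does not vary
  with its last argument, \<open>y'\<close> is arbitrary.\<close>

lemma restrict_compressed_tail_frontier:
  assumes "(X, Z, \<Phi>) \<in> compressed_tail_frontier T U \<Phi>T \<sigma> t y" "t \<le> k"
  shows "(restrict X {k..T}, restrict Z {k..T}, restrict \<Phi> {k..T})
           \<in> compressed_tail_frontier T U \<Phi>T \<sigma> k y'"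
proof -
  \<comment> \<open>For \<open>j < T\<close> the index \<open>Suc j\<close> survives the
    restriction; for \<open>j = T\<close> both sides are the terminal input, inserted after the
    restriction.\<close>
  have next_premium: "((restrict \<Phi> {k..T})(Suc T := \<Phi>T)) (Suc j) = (\<Phi>(Suc T := \<Phi>T)) (Suc j)"
    if "j \<in> {k..T}" for j
    using that by auto
  have "X \<in> payoffs t T" "Z \<in> adapted_info \<sigma> t T" "\<Phi> \<in> adapted_info \<sigma> t T"
    and step: "\<And>j y. j \<in> {t..T} \<Longrightarrow> y \<in> \<sigma> j ` hists j \<Longrightarrow>
      (given_hist (Suc j) (some_hist j (\<sigma> j) y) (X j),
       Z j (some_hist j (\<sigma> j) y), \<Phi> j (some_hist j (\<sigma> j) y))
        \<in> compressed_frontier \<sigma> U j y ((\<Phi>(Suc T := \<Phi>T)) (Suc j))"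
    using assms(1) unfolding compressed_tail_frontier_def by blast+
  then show ?thesis
    unfolding compressed_tail_frontier_def mem_Collect_eq case_prod_conv
  proof (intro conjI ballI)
    fix j y assume j: "j \<in> {k..T}" and y: "y \<in> \<sigma> j ` hists j"
    with \<open>t \<le> k\<close> have "j \<in> {t..T}" by simp
    from step[OF this y] show "(given_hist (Suc j) (some_hist j (\<sigma> j) y) (restrict X {k..T} j),
        restrict Z {k..T} j (some_hist j (\<sigma> j) y), restrict \<Phi> {k..T} j (some_hist j (\<sigma> j) y))
        \<in> compressed_frontier \<sigma> U j y (((restrict \<Phi> {k..T})(Suc T := \<Phi>T)) (Suc j))"
      unfolding next_premium[OF j] using j by simp
  qed (simp_all add: restrict_payoffs restrict_adapted_info \<open>t \<le> k\<close>)
qed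

text \<open>The state is a function of the information state, so a representative of the information
  state of \<open>h\<close> has the same state as \<open>h\<close>. This links the payoff in the
  tail frontier to the payoff conditioned on the state.\<close>

lemma given_hist_markov:
  assumes "information_state T f s0 Y \<sigma>" "markov f s0 t T X" "k \<in> {t..T}" "h \<in> hists k"
  shows "given_hist (Suc k) (some_hist k (\<sigma> k) (\<sigma> k h)) (X k) =
         given_hist (Suc k) (some_hist k (state f s0 k) (state f s0 k h)) (X k)"
proof -
  let ?h = "some_hist k (\<sigma> k) (\<sigma> k h)"
  obtain \<pi> where \<pi>: "\<And>h. h \<in> hists k \<Longrightarrow> state f s0 k h = \<pi> (\<sigma> k h)"
    using assms(1,3) by (auto simp: information_state_def)
  have "state f s0 k ?h = state f s0 k h"
    using \<pi> some_hist[OF assms(4), of "\<sigma> k"] assms(4) by simp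
  moreover have "given_hist (Suc k) ?h (X k) =
      given_hist (Suc k) (some_hist k (state f s0 k) (state f s0 k ?h)) (X k)"
    using assms(2,3) some_hist(1)[OF assms(4)] unfolding markov_def by blast
  ultimately show ?thesis by simp
qed

section \<open>Minimal premiums as a lower bound for continuations\<close>

lemma info_risk_is_minimum:
  assumes "info_risk_well_defined T f s0 U \<Phi>T \<sigma>"
    and "t \<le> T" "X \<in> payoffs_info \<sigma> t T" "markov f s0 t T X" "h \<in> hists t"
  shows "is_minimum (info_premiums T U \<Phi>T \<sigma> t X (\<sigma> t h)) (info_risk T U \<Phi>T \<sigma> t X (\<sigma> t h))"
proof -
  obtain m where m: "is_minimum (info_premiums T U \<Phi>T \<sigma> t X (\<sigma> t h)) m"
    using assms unfolding info_risk_well_defined_def by blast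
  moreover have "(LEAST \<phi>. \<phi> \<in> info_premiums T U \<Phi>T \<sigma> t X (\<sigma> t h)) = m"
    using m by (intro Least_equality) (auto simp: is_minimum_def)
  ultimately show ?thesis using \<open>t \<le> T\<close> by (simp add: info_risk_def)
qed

lemma info_risk_rv_terminal:
  assumes "\<Phi>T \<in> rv_info \<sigma> (Suc T)"
  shows "info_risk_rv T U \<Phi>T \<sigma> (Suc T) X = \<Phi>T"
proof (rule extensionalityI[of _ "hists (Suc T)"])
  show "\<Phi>T \<in> extensional (hists (Suc T))"
    using assms by (simp add: rv_info_def rv_def)
qed (simp_all add: info_risk_rv_def info_risk_def rv_info_some_hist[OF assms])

text \<open>One feasible process restricts to a feasible process of the next tail problem at all
  information states simultaneously, so its premium competes in each of those minima. At
  \<open>t = T\<close> both sides are the terminal input.\<close>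

lemma info_risk_rv_le_continuation:
  assumes "info_risk_well_defined T f s0 U \<Phi>T \<sigma>" "\<Phi>T \<in> rv_info \<sigma> (Suc T)"
    and "t \<le> T" "X \<in> payoffs_info \<sigma> t T" "markov f s0 t T X"
    and feasible: "(X, Z, \<Phi>) \<in> compressed_tail_frontier T U \<Phi>T \<sigma> t y"
  shows "le_rv (Suc t) (info_risk_rv T U \<Phi>T \<sigma> (Suc t) (restrict X {Suc t..T}))
           ((\<Phi>(Suc T := \<Phi>T)) (Suc t))"
proof (cases "t = T")
  case True
  then show ?thesis
    using info_risk_rv_terminal[OF assms(2)] by (simp add: le_rv_def)
next
  case False
  with \<open>t \<le> T\<close> have t: "Suc t \<le> T" by simp
  have \<Phi>: "\<Phi> (Suc t) \<in> rv_info \<sigma> (Suc t)"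
    using feasible t by (auto simp: compressed_tail_frontier_def adapted_info_def)
  have "info_risk T U \<Phi>T \<sigma> (Suc t) (restrict X {Suc t..T}) (\<sigma> (Suc t) h) \<le> \<Phi> (Suc t) h"
    if h: "h \<in> hists (Suc t)" for h
  proof -
    have "restrict \<Phi> {Suc t..T} (Suc t) (some_hist (Suc t) (\<sigma> (Suc t)) (\<sigma> (Suc t) h))
        \<in> info_premiums T U \<Phi>T \<sigma> (Suc t) (restrict X {Suc t..T}) (\<sigma> (Suc t) h)"
      unfolding info_premiums_def mem_Collect_eq
      by (intro exI conjI) (rule refl, rule restrict_compressed_tail_frontier[OF feasible], simp)
    \<comment> \<open>The premium depends only on the information state, so its value at the
      representative is its value at \<open>h\<close>.\<close>
    then have "\<Phi> (Suc t) h \<in> info_premiums T U \<Phi>T \<sigma> (Suc t) (restrict X {Suc t..T}) (\<sigma> (Suc t) h)"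
      using t rv_info_some_hist[OF \<Phi> h] by simp
    moreover have "is_minimum
        (info_premiums T U \<Phi>T \<sigma> (Suc t) (restrict X {Suc t..T}) (\<sigma> (Suc t) h))
        (info_risk T U \<Phi>T \<sigma> (Suc t) (restrict X {Suc t..T}) (\<sigma> (Suc t) h))"
      by (rule info_risk_is_minimum[OF assms(1) t restrict_payoffs_info[OF assms(4)]
            restrict_markov[OF assms(5)] h]) simp_all
    ultimately show ?thesis by (simp add: is_minimum_def)
  qed
  then show ?thesis
    using t by (simp add: le_rv_def info_risk_rv_def)
qed

section \<open>The two halves of the one-step minimum\<close>

text \<open>A minimizer meets the period-\<open>t\<close> constraint with its own continuation as
  input. The minimal premiums of the next period are a smaller input, and by (c) a smaller input
  gives a larger one-step frontier.\<close>

lemma info_risk_one_step_feasible: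
  assumes "recursive_structure T \<U> U \<Phi>T"
    and "info_risk_well_defined T f s0 U \<Phi>T \<sigma>" "\<Phi>T \<in> rv_info \<sigma> (Suc T)"
    and "t \<le> T" "X \<in> payoffs_info \<sigma> t T" "markov f s0 t T X" "h \<in> hists t"
  shows "\<exists>z. (given_hist (Suc t) (some_hist t (\<sigma> t) (\<sigma> t h)) (X t), z, info_risk T U \<Phi>T \<sigma> t X (\<sigma> t h))
           \<in> compressed_frontier \<sigma> U t (\<sigma> t h)
               (info_risk_rv T U \<Phi>T \<sigma> (Suc t) (restrict X {Suc t..T}))"
proof -
  let ?h = "some_hist t (\<sigma> t) (\<sigma> t h)"
  let ?\<rho> = "info_risk_rv T U \<Phi>T \<sigma> (Suc t) (restrict X {Suc t..T})"
  have "info_risk T U \<Phi>T \<sigma> t X (\<sigma> t h) \<in> info_premiums T U \<Phi>T \<sigma> t X (\<sigma> t h)"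
    using info_risk_is_minimum[OF assms(2,4-7)] by (simp add: is_minimum_def)
  then obtain Z \<Phi> where \<Phi>: "info_risk T U \<Phi>T \<sigma> t X (\<sigma> t h) = \<Phi> t ?h"
    and feasible: "(X, Z, \<Phi>) \<in> compressed_tail_frontier T U \<Phi>T \<sigma> t (\<sigma> t h)"
    unfolding info_premiums_def by blast
  let ?\<Phi>' = "(\<Phi>(Suc T := \<Phi>T)) (Suc t)"
  have "\<forall>k\<in>{t..T}. \<forall>y\<in>\<sigma> k ` hists k.
      (given_hist (Suc k) (some_hist k (\<sigma> k) y) (X k),
       Z k (some_hist k (\<sigma> k) y), \<Phi> k (some_hist k (\<sigma> k) y))
        \<in> compressed_frontier \<sigma> U k y ((\<Phi>(Suc T := \<Phi>T)) (Suc k))"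
    using feasible unfolding compressed_tail_frontier_def by blast
  then have "(given_hist (Suc t) ?h (X t), Z t ?h, \<Phi> t ?h) \<in> U t ?h ?\<Phi>'"
    using assms(4,7) by (simp add: compressed_frontier_def del: fun_upd_apply)
  moreover have "U t ?h ?\<Phi>' \<subseteq> U t ?h ?\<rho>"
  proof -
    have "?\<rho> \<in> rv (Suc t)"
      by (simp add: info_risk_rv_def rv_def)
    \<comment> \<open>Property (c) compares only inputs in \<open>rv (Suc t)\<close>. At
      \<open>t = T\<close> the input is the terminal one, since \<open>\<Phi>\<close> itself ends at
      period \<open>T\<close>.\<close>
    moreover have "?\<Phi>' \<in> rv (Suc t)"
    proof (cases "t = T")
      case True
      then show ?thesis using assms(3) by (simp add: rv_info_def)
    next
      case False
      have "\<Phi> \<in> adapted_info \<sigma> t T"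
        using feasible unfolding compressed_tail_frontier_def by blast
      then have "\<Phi> (Suc t) \<in> rv_info \<sigma> (Suc t)"
        unfolding adapted_info_def by (rule PiE_mem) (use False \<open>t \<le> T\<close> in simp)
      with False show ?thesis by (simp add: rv_info_def)
    qed
    moreover have "le_rv (Suc t) ?\<rho> ?\<Phi>'"
      by (rule info_risk_rv_le_continuation[OF assms(2-6) feasible])
    ultimately show ?thesis
      by (rule frontier_antimono[OF assms(1,4) some_hist(1)[OF assms(7)]])
  qed
  ultimately show ?thesis
    unfolding compressed_frontier_def \<Phi> by blast
qed

text \<open>No constraint of the tail problem takes a period-\<open>t\<close> premium as input. The
  premium at the current information state can therefore be changed to \<open>\<phi>\<close> without
  disturbing the constraints elsewhere.\<close>

lemma info_risk_le_one_step:
  assumes "recursive_structure T \<U> U \<Phi>T"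
    and "info_risk_well_defined T f s0 U \<Phi>T \<sigma>" "\<Phi>T \<in> rv_info \<sigma> (Suc T)"
    and "t \<le> T" and X: "X \<in> payoffs_info \<sigma> t T" and "markov f s0 t T X" and h: "h \<in> hists t"
    and step: "(given_hist (Suc t) (some_hist t (\<sigma> t) (\<sigma> t h)) (X t), z, \<phi>)
           \<in> compressed_frontier \<sigma> U t (\<sigma> t h)
               (info_risk_rv T U \<Phi>T \<sigma> (Suc t) (restrict X {Suc t..T}))"
  shows "info_risk T U \<Phi>T \<sigma> t X (\<sigma> t h) \<le> \<phi>"
proof -
  let ?\<rho> = "\<lambda>k. info_risk T U \<Phi>T \<sigma> k (restrict X {k..T})"
  let ?next = "\<lambda>k. info_risk_rv T U \<Phi>T \<sigma> (Suc k) (restrict X {Suc k..T})"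
  have "\<exists>\<zeta>. (given_hist (Suc k) (some_hist k (\<sigma> k) y) (X k), \<zeta>, ?\<rho> k y)
      \<in> compressed_frontier \<sigma> U k y (?next k)" if k: "k \<in> {t..T}" and y: "y \<in> \<sigma> k ` hists k" for k y
  proof -
    obtain g where g: "g \<in> hists k" "y = \<sigma> k g" using y by blast
    have "restrict (restrict X {k..T}) {Suc k..T} = restrict X {Suc k..T}"
      by (auto simp: restrict_def fun_eq_iff)
    then show ?thesis
      using info_risk_one_step_feasible[OF assms(1-3) _ restrict_payoffs_info[OF X]
          restrict_markov[OF assms(6)] g(1)] k
      by (auto simp: g(2))
  qed
  \<comment> \<open>The disbursements are chosen separately at each period and information state,
    where they may stem from different minimizers; the one-step constraints need no common
    process.\<close>
  then obtain \<zeta> where \<zeta>: "\<And>k y. k \<in> {t..T} \<Longrightarrow> y \<in> \<sigma> k ` hists k \<Longrightarrow>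
      (given_hist (Suc k) (some_hist k (\<sigma> k) y) (X k), \<zeta> k y, ?\<rho> k y)
        \<in> compressed_frontier \<sigma> U k y (?next k)"
    by metis
  \<comment> \<open>\<open>cur\<close> marks the single place where the given pair \<open>z\<close>,
    \<open>\<phi>\<close> replaces the chosen disbursement and the minimal premium.\<close>
  define cur where "cur k y \<longleftrightarrow> k = t \<and> y = \<sigma> t h" for k y
  define Z where "Z = (\<lambda>k\<in>{t..T}. \<lambda>g\<in>hists k. if cur k (\<sigma> k g) then z else \<zeta> k (\<sigma> k g))"
  define \<Phi> where "\<Phi> = (\<lambda>k\<in>{t..T}. \<lambda>g\<in>hists k. if cur k (\<sigma> k g) then \<phi> else ?\<rho> k (\<sigma> k g))"
  have adapted: "Z \<in> adapted_info \<sigma> t T" "\<Phi> \<in> adapted_info \<sigma> t T"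
    unfolding Z_def \<Phi>_def adapted_info_def
    using rv_info_restrict[where g = "\<lambda>y. if cur k y then z else \<zeta> k y" and \<sigma> = \<sigma> for k]
      rv_info_restrict[where g = "\<lambda>y. if cur k y then \<phi> else ?\<rho> k y" and \<sigma> = \<sigma> for k]
    by (simp_all add: restrict_PiE_iff)
  \<comment> \<open>Inputs come from periods \<open>Suc k > t\<close>, where \<open>cur\<close> is
    false, so they are exactly the minimal premiums for which \<open>\<zeta>\<close> and
    \<open>step\<close> were stated.\<close>
  have continuation: "(\<Phi>(Suc T := \<Phi>T)) (Suc k) = ?next k" if "k \<in> {t..T}" for k
  proof (cases "k = T")
    case True
    then show ?thesis using info_risk_rv_terminal[OF assms(3)] by simp
  next
    case False
    with that show ?thesis
      by (auto simp: \<Phi>_def cur_def info_risk_rv_def)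
  qed
  have at: "Z k (some_hist k (\<sigma> k) y) = (if cur k y then z else \<zeta> k y)"
      "\<Phi> k (some_hist k (\<sigma> k) y) = (if cur k y then \<phi> else ?\<rho> k y)"
    if k: "k \<in> {t..T}" and y: "y \<in> \<sigma> k ` hists k" for k y
    using y some_hist[of _ k "\<sigma> k"] k by (auto simp: Z_def \<Phi>_def)
  have "(X, Z, \<Phi>) \<in> compressed_tail_frontier T U \<Phi>T \<sigma> t (\<sigma> t h)"
    unfolding compressed_tail_frontier_def mem_Collect_eq case_prod_conv
  proof (intro conjI ballI)
    fix k y assume k: "k \<in> {t..T}" and y: "y \<in> \<sigma> k ` hists k"
    show "(given_hist (Suc k) (some_hist k (\<sigma> k) y) (X k), Z k (some_hist k (\<sigma> k) y),
        \<Phi> k (some_hist k (\<sigma> k) y)) \<in> compressed_frontier \<sigma> U k y ((\<Phi>(Suc T := \<Phi>T)) (Suc k))"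
      unfolding continuation[OF k] at[OF k y]
      using \<zeta>[OF k y] step by (auto simp: cur_def)
  qed (use adapted payoffs_info_imp_payoffs[OF X] in auto)
  moreover have "\<Phi> t (some_hist t (\<sigma> t) (\<sigma> t h)) = \<phi>"
    using at(2)[of t "\<sigma> t h"] h \<open>t \<le> T\<close> by (simp add: cur_def)
  ultimately have "\<phi> \<in> info_premiums T U \<Phi>T \<sigma> t X (\<sigma> t h)"
    unfolding info_premiums_def by blast
  then show ?thesis
    using info_risk_is_minimum[OF assms(2,4-7)] by (simp add: is_minimum_def)
qed

theorem theorem22:
  fixes T :: nat
    and f :: "nat \<Rightarrow> 's::finite \<Rightarrow> 'x::finite \<Rightarrow> 's" and s0 :: 's
    and P :: "nat \<Rightarrow> 'x pmf"
    and \<U> :: "((nat \<Rightarrow> 'x list \<Rightarrow> real) \<times> (nat \<Rightarrow> 'x list \<Rightarrow> real) \<times> (nat \<Rightarrow> 'x list \<Rightarrow> real)) set"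
    and U :: "'x frontiers" and \<Phi>T :: "'x list \<Rightarrow> real"
    and Y :: "nat \<Rightarrow> 'y::banach set" and \<sigma> :: "nat \<Rightarrow> 'x list \<Rightarrow> 'y"
  assumes "risk_frontier T P \<U>"
    and "recursive_structure T \<U> U \<Phi>T"
    and "information_state_generator T f s0 P U \<Phi>T Y \<sigma>"
    and "info_risk_well_defined T f s0 U \<Phi>T \<sigma>"
  shows "\<forall>t\<le>T. \<forall>X\<in>payoffs_info \<sigma> t T. markov f s0 t T X \<longrightarrow>
           (\<forall>h\<in>hists t.
              is_minimum
                {\<phi>. \<exists>z. (given_hist (Suc t) (some_hist t (state f s0 t) (state f s0 t h)) (X t), z, \<phi>)
                  \<in> compressed_frontier \<sigma> U t (\<sigma> t h)
                      (info_risk_rv T U \<Phi>T \<sigma> (Suc t) (restrict X {Suc t..T}))}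
                (info_risk T U \<Phi>T \<sigma> t X (\<sigma> t h)))"
proof (intro allI impI ballI)
  fix t X and h :: "'x list"
  assume t: "t \<le> T" and X: "X \<in> payoffs_info \<sigma> t T" and m: "markov f s0 t T X" and h: "h \<in> hists t"
  have info: "information_state T f s0 Y \<sigma>" "\<Phi>T \<in> rv_info \<sigma> (Suc T)"
    using assms(3) unfolding information_state_generator_def by blast+
  have payoff: "given_hist (Suc t) (some_hist t (\<sigma> t) (\<sigma> t h)) (X t) =
      given_hist (Suc t) (some_hist t (state f s0 t) (state f s0 t h)) (X t)"
    using given_hist_markov[OF info(1) m _ h] t by simp
  show "is_minimum
      {\<phi>. \<exists>z. (given_hist (Suc t) (some_hist t (state f s0 t) (state f s0 t h)) (X t), z, \<phi>)
        \<in> compressed_frontier \<sigma> U t (\<sigma> t h)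
            (info_risk_rv T U \<Phi>T \<sigma> (Suc t) (restrict X {Suc t..T}))}
      (info_risk T U \<Phi>T \<sigma> t X (\<sigma> t h))"
    \<comment> \<open>The first fact gives membership in the one-step set, the second the lower
      bound; \<open>payoff\<close> exchanges the two representatives.\<close>
    using info_risk_one_step_feasible[OF assms(2,4) info(2) t X m h]
      info_risk_le_one_step[OF assms(2,4) info(2) t X m h]
    unfolding is_minimum_def payoff by blast
qed

end
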